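(* Let $p\geq 5$ be prime and $C_{E,p}:=\left(\frac{\log(p+1)}{\log p}-1\right)^{-1}$. Every linear system $M\cdot x=a$ over $\mathbb{F}_p$, where $M$ is an $m\times n$ matrix (i.e. $m$ equations) with $d_M\geq C_{E,p}\cdot m^3$, has a solution $x\in\{0,1\}^n$.
   Context: For $v\in\mathbb{F}_p^n$, $\omega(v)$ is the number of nonzero coordinates of $v$; $d_M:=\min_{y\in\mathbb{F}_p^m,\,y\neq 0}\omega(y\cdot M)$. *)

theory Defs
  imports
    Complex_Main
    "Berlekamp_Zassenhaus.Finite_Field"
    "Jordan_Normal_Form.Matrix"
begin

text \<open>
  The field with \<open>p\<close> elements is \<open>'p mod_ring\<close> with \<open>'p :: prime_card\<close>; the class
  states that \<open>p = CARD('p)\<close> is prime.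
\<close>

definition hamming_weight :: "'a :: zero vec \<Rightarrow> nat" where
  "hamming_weight v = card {i. i < dim_vec v \<and> v $ i \<noteq> 0}"

text \<open>
  The quantity \<open>d\<^sub>M\<close>; the row vector \<open>y \<cdot> M\<close> is written \<open>transpose_mat M *\<^sub>v y\<close>.
  The condition \<open>y \<noteq> 0\<close> is on \<open>y\<close>, not on \<open>y \<cdot> M\<close>: linearly dependent rows give the
  value \<open>0\<close>. If \<open>M\<close> has no rows, the minimum is over the empty set and unspecified.
\<close>

definition min_weight :: "'p :: prime_card mod_ring mat \<Rightarrow> nat" where
  "min_weight M =
     Min {hamming_weight (transpose_mat M *\<^sub>v y) | y.
       y \<in> carrier_vec (dim_row M) \<and> y \<noteq> 0\<^sub>v (dim_row M)}"

definition C_E :: "nat \<Rightarrow> real" where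
  "C_E p = inverse (ln (real (p + 1)) / ln (real p) - 1)"

end

theory Submission
  imports Defs "HOL-Library.Function_Algebras" "HOL-Library.FuncSet"
begin

text \<open>
  Add columns of \<open>M\<close> one at a time, keeping track of the set \<open>S\<close> of subset sums of the
  columns used so far. For fixed \<open>S\<close>, the number \<open>\<delta>(g)\<close> of elements of \<open>g + S\<close> outside \<open>S\<close> is
  subadditive and even in \<open>g\<close>, and its average over the group of order \<open>N = p^m\<close> is
  \<open>|S| (1 - |S| / N)\<close>. As long as fewer than \<open>d\<^sub>M\<close> columns have been used, the others span
  \<open>F_p^m\<close>, so every \<open>g\<close> is a combination of \<open>m\<close> of them, with coefficients of absolute value at
  most \<open>(p - 1) / 2\<close>. Hence some unused column \<open>v\<close> satisfies \<open>\<delta>(v) \<ge> r |S| (1 - |S| / N)\<close>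
  with \<open>r = 2 / (m (p - 1))\<close>, and adding it multiplies the odds \<open>|S| / (N - |S|)\<close> by at least
  \<open>1 + r\<close>. After \<open>d\<^sub>M\<close> steps the odds would exceed \<open>N - 1\<close>, which forces \<open>|S| = N\<close>.
\<close>

subsection \<open>The shift defect of a set\<close>

definition defect :: "'a::ab_group_add set \<Rightarrow> 'a \<Rightarrow> nat" where
  "defect S g = card ((+) g ` S - S)"

lemma defect_zero [simp]: "defect S 0 = 0"
  by (simp add: defect_def)

text \<open>If \<open>g + h + s\<close> lies outside \<open>S\<close>, then either
  \<open>h + s\<close> is already outside \<open>S\<close>, or it is a point of \<open>S\<close>
  that \<open>g\<close> moves out. Translation by \<open>g\<close> preserves the number of points of
  the first kind.\<close>

lemma defect_add_le:
  assumes "finite S"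
  shows "defect S (g + h) \<le> defect S g + defect S h"
proof -
  have "(+) (g + h) ` S - S \<subseteq> (+) g ` ((+) h ` S - S) \<union> ((+) g ` S - S)"
    by (auto simp: add.assoc)
  then have "defect S (g + h) \<le> card ((+) g ` ((+) h ` S - S) \<union> ((+) g ` S - S))"
    unfolding defect_def using assms by (intro card_mono) auto
  also have "\<dots> \<le> card ((+) g ` ((+) h ` S - S)) + card ((+) g ` S - S)"
    by (rule card_Un_le)
  also have "\<dots> = defect S h + defect S g"
    by (simp add: defect_def card_image)
  finally show ?thesis by simp
qed

text \<open>Translation by \<open>g\<close> turns the part of \<open>- g + S\<close> outside
  \<open>S\<close> into the part of \<open>S\<close> outside \<open>g + S\<close>. Since
  \<open>S\<close> and \<open>g + S\<close> have equal size, their two differences do too.\<close>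

lemma defect_minus:
  assumes "finite S"
  shows "defect S (- g) = defect S g"
proof -
  have "(+) g ` ((+) (- g) ` S - S) = S - (+) g ` S"
  proof (intro equalityI subsetI)
    fix x assume "x \<in> S - (+) g ` S"
    then have "x - g \<in> (+) (- g) ` S - S"
      by (force simp: image_iff)
    then show "x \<in> (+) g ` ((+) (- g) ` S - S)"
      by (intro image_eqI[of _ _ "x - g"]) auto
  qed auto
  then have "defect S (- g) = card (S - (+) g ` S)"
    unfolding defect_def by (metis card_image inj_on_add)
  also have "\<dots> = card ((+) g ` S - S)"
  proof -
    have "card (S - (+) g ` S) = card S - card (S \<inter> (+) g ` S)"
      using assms by (intro card_Diff_subset_Int) auto
    moreover have "card ((+) g ` S - S) = card ((+) g ` S) - card ((+) g ` S \<inter> S)"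
      using assms by (intro card_Diff_subset_Int) auto
    ultimately show ?thesis
      by (simp add: card_image Int_commute)
  qed
  finally show ?thesis by (simp add: defect_def)
qed

lemma defect_sum_le:
  assumes "finite S" "finite K"
  shows "defect S (\<Sum>j\<in>K. f j) \<le> (\<Sum>j\<in>K. defect S (f j))"
  using assms(2)
proof induction
  case (insert j K)
  then show ?case
    using defect_add_le[OF assms(1), of "f j" "sum f K"] by simp
qed simp

lemma defect_of_nat_mult_le:
  fixes v :: "'i \<Rightarrow> 'b::comm_ring_1"
  assumes "finite S"
  shows "defect S (\<lambda>i. of_nat k * v i) \<le> k * defect S v"
proof (induction k)
  case 0
  then show ?case by (simp flip: zero_fun_def)
next
  case (Suc k)
  have "(\<lambda>i. of_nat (Suc k) * v i) = v + (\<lambda>i. of_nat k * v i)"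
    by (auto simp: fun_eq_iff algebra_simps)
  then show ?case
    using defect_add_le[OF assms, of v "\<lambda>i. of_nat k * v i"] Suc by simp
qed

text \<open>For odd \<open>p\<close> every residue is \<open>k\<close> or \<open>- k\<close> with
  \<open>2 * k \<le> p - 1\<close>, and the sign does not change the defect.\<close>

lemma defect_mod_ring_mult_le:
  fixes v :: "'i \<Rightarrow> 'p::prime_card mod_ring"
  assumes "finite S" "odd CARD('p)"
  shows "2 * defect S (\<lambda>i. c * v i) \<le> (CARD('p) - 1) * defect S v"
proof -
  obtain k where k: "k < CARD('p)" "c = of_nat k"
    using surj_of_nat_mod_ring by blast
  show ?thesis
  proof (cases "2 * k \<le> CARD('p) - 1")
    case True
    have "2 * defect S (\<lambda>i. c * v i) \<le> 2 * k * defect S v"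
      using defect_of_nat_mult_le[OF assms(1), of k v] k(2) by simp
    also have "\<dots> \<le> (CARD('p) - 1) * defect S v"
      using True by (rule mult_right_mono) simp
    finally show ?thesis .
  next
    case False
    \<comment> \<open>Parity enters here: \<open>2 * k > p - 1\<close> with \<open>p\<close> odd
      gives \<open>2 * k \<ge> p + 1\<close>.\<close>
    then have le: "2 * (CARD('p) - k) \<le> CARD('p) - 1"
      using assms(2) by presburger
    have "- c = of_nat (CARD('p) - k)"
      using k by (simp add: of_nat_diff)
    then have "- (\<lambda>i. c * v i) = (\<lambda>i. of_nat (CARD('p) - k) * v i)"
      by (simp add: fun_eq_iff flip: mult_minus_left)
    then have "2 * defect S (\<lambda>i. c * v i) \<le> 2 * (CARD('p) - k) * defect S v"
      using defect_of_nat_mult_le[OF assms(1), of "CARD('p) - k" v]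
        defect_minus[OF assms(1), of "\<lambda>i. c * v i"] by simp
    also have "\<dots> \<le> (CARD('p) - 1) * defect S v"
      using le by (rule mult_right_mono) simp
    finally show ?thesis .
  qed
qed

text \<open>Double counting of the pairs \<open>(g, s)\<close> with \<open>s \<in> S\<close> and
  \<open>g + s \<notin> S\<close>: for fixed \<open>s\<close>, the map
  \<open>g \<mapsto> g + s\<close> sends the admissible \<open>g\<close> bijectively onto
  \<open>G - S\<close>. The group is a subset \<open>G\<close> with closure assumptions because the
  ambient function type may be infinite.\<close>

lemma sum_defect:
  assumes "finite G" "S \<subseteq> G"
    and add: "\<And>x y. x \<in> G \<Longrightarrow> y \<in> G \<Longrightarrow> x + y \<in> G"
    and diff: "\<And>x y. x \<in> G \<Longrightarrow> y \<in> G \<Longrightarrow> x - y \<in> G"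
  shows "(\<Sum>g\<in>G. defect S g) = card S * (card G - card S)"
proof -
  have fin: "finite S" using assms finite_subset by blast
  have "(\<Sum>g\<in>G. defect S g) = (\<Sum>g\<in>G. card {s \<in> S. g + s \<notin> S})"
  proof (rule sum.cong)
    fix g
    have "(+) g ` S - S = (+) g ` {s \<in> S. g + s \<notin> S}" by auto
    then show "defect S g = card {s \<in> S. g + s \<notin> S}"
      by (simp add: defect_def card_image)
  qed simp
  also have "\<dots> = (\<Sum>s\<in>S. card {g \<in> G. g + s \<notin> S})"
    using assms(1) fin by (intro sum_multicount_gen) auto
  also have "\<dots> = (\<Sum>s\<in>S. card (G - S))"
  proof (rule sum.cong)
    fix s assume "s \<in> S"
    then have "s \<in> G" using assms(2) by blast
    then have "G - S = (\<lambda>g. g + s) ` {g \<in> G. g + s \<notin> S}"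
      using add diff by (auto intro!: image_eqI[where x = "_ - s"])
    then show "card {g \<in> G. g + s \<notin> S} = card (G - S)"
      by (simp add: card_image)
  qed simp
  finally show ?thesis
    using assms fin by (simp add: card_Diff_subset)
qed

text \<open>Some \<open>g\<close> reaches the average of the defects; denominators are cleared to
  stay in \<open>nat\<close>.\<close>

lemma exists_defect_ge:
  assumes "finite G" "S \<subseteq> G" "G \<noteq> {}"
    and add: "\<And>x y. x \<in> G \<Longrightarrow> y \<in> G \<Longrightarrow> x + y \<in> G"
    and diff: "\<And>x y. x \<in> G \<Longrightarrow> y \<in> G \<Longrightarrow> x - y \<in> G"
  obtains g where "g \<in> G" "card S * (card G - card S) \<le> card G * defect S g"
proof -
  have "\<exists>g\<in>G. card S * (card G - card S) \<le> card G * defect S g"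
  proof (rule ccontr)
    assume "\<not> ?thesis"
    then have "(\<Sum>g\<in>G. card G * defect S g) < (\<Sum>g\<in>G. card S * (card G - card S))"
      using assms by (intro sum_strict_mono) (auto simp: not_le)
    also have "\<dots> = card G * (\<Sum>g\<in>G. defect S g)"
      using sum_defect[of G S] assms by simp
    finally show False by (simp add: sum_distrib_left)
  qed
  then show thesis using that by blast
qed

subsection \<open>Bases among spanning families\<close>

text \<open>Model of the coordinate space over \<open>A\<close>: the value 0 outside
  \<open>A\<close> makes the representing function unique, and addition is pointwise, so the lemmas
  on abelian groups apply directly.\<close>

definition supp_on :: "'i set \<Rightarrow> ('i \<Rightarrow> 'b::zero) set" where
  "supp_on A = {f. \<forall>i. i \<notin> A \<longrightarrow> f i = 0}"

lemma zero_in_supp_on [simp]: "0 \<in> supp_on A"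
  by (simp add: supp_on_def)

lemma supp_on_add: "f \<in> supp_on A \<Longrightarrow> g \<in> supp_on A \<Longrightarrow> f + g \<in> supp_on A"
  for f g :: "'i \<Rightarrow> 'b::monoid_add"
  by (simp add: supp_on_def)

lemma supp_on_diff: "f \<in> supp_on A \<Longrightarrow> g \<in> supp_on A \<Longrightarrow> f - g \<in> supp_on A"
  for f g :: "'i \<Rightarrow> 'b::group_add"
  by (simp add: supp_on_def)

lemma bij_betw_supp_on:
  "bij_betw (\<lambda>f i. if i \<in> A then f i else 0) (A \<rightarrow>\<^sub>E (UNIV :: 'b::zero set)) (supp_on A)"
  by (rule bij_betw_byWitness[where f' = "\<lambda>f. restrict f A"])
    (auto simp: supp_on_def PiE_def extensional_def restrict_def)

lemma card_supp_on:
  assumes "finite A"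
  shows "card (supp_on A :: ('i \<Rightarrow> 'b::{zero,finite}) set) = CARD('b) ^ card A"
  using bij_betw_same_card[OF bij_betw_supp_on[of A, where 'b = 'b]] assms
  by (simp add: card_PiE)

lemma finite_supp_on:
  assumes "finite A"
  shows "finite (supp_on A :: ('i \<Rightarrow> 'b::{zero,finite}) set)"
  using bij_betw_finite[OF bij_betw_supp_on[of A, where 'b = 'b]] assms
  by (simp add: finite_PiE)

text \<open>Pigeonhole instead of a dimension count: the map from \<open>y\<close> to its pairings
  with the \<open>v j\<close> has fewer possible values than arguments, and the difference of two
  arguments with the same value is orthogonal to every \<open>v j\<close>.\<close>

lemma exists_orthogonal:
  fixes v :: "'j \<Rightarrow> 'i \<Rightarrow> 'b::{field,finite}"
  assumes "finite A" "finite K" "card K < card A"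
  obtains y where "y \<in> supp_on A" "y \<noteq> 0" "\<And>j. j \<in> K \<Longrightarrow> (\<Sum>i\<in>A. y i * v j i) = 0"
proof -
  define \<phi> where "\<phi> y = (\<lambda>j. if j \<in> K then \<Sum>i\<in>A. y i * v j i else 0)" for y
  have "CARD('b) > 1"
    using card_mono[of UNIV "{0, 1 :: 'b}"] by simp
  then have "card (supp_on K :: ('j \<Rightarrow> 'b) set) < card (supp_on A :: ('i \<Rightarrow> 'b) set)"
    using assms by (simp add: card_supp_on)
  moreover have "\<phi> ` supp_on A \<subseteq> supp_on K"
    by (auto simp: \<phi>_def supp_on_def)
  ultimately have "\<not> inj_on \<phi> (supp_on A)"
    using card_inj_on_le[of \<phi> "supp_on A" "supp_on K"] finite_supp_on[OF assms(2)]
    by (meson not_le)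
  then obtain y z where yz: "y \<in> supp_on A" "z \<in> supp_on A" "y \<noteq> z" "\<phi> y = \<phi> z"
    by (auto simp: inj_on_def)
  show thesis
  proof
    show "y - z \<in> supp_on A" "y - z \<noteq> 0"
      using yz supp_on_diff by auto
    fix j assume "j \<in> K"
    then show "(\<Sum>i\<in>A. (y - z) i * v j i) = 0"
      using fun_cong[OF yz(4), of j] by (simp add: \<phi>_def left_diff_distrib sum_subtractf)
  qed
qed

text \<open>The condition \<open>sep\<close> is the dual form of spanning. It feeds a greedy choice:
  fewer than \<open>card A\<close> vectors have a common nonzero orthogonal \<open>y\<close>, and a
  vector of the family not orthogonal to \<open>y\<close> can be added.\<close>

lemma exists_independent:
  fixes v :: "'j \<Rightarrow> 'i \<Rightarrow> 'b::{field,finite}"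
  assumes "finite A"
    and sep: "\<And>y. y \<in> supp_on A \<Longrightarrow> y \<noteq> 0 \<Longrightarrow> \<exists>j\<in>J. (\<Sum>i\<in>A. y i * v j i) \<noteq> 0"
    and "k \<le> card A"
  shows "\<exists>K\<subseteq>J. finite K \<and> card K = k \<and>
    (\<forall>c\<in>supp_on K. (\<forall>i\<in>A. (\<Sum>j\<in>K. c j * v j i) = 0) \<longrightarrow> c = 0)"
  using assms(3)
proof (induction k)
  case 0
  then show ?case by (intro exI[of _ "{}"]) (auto simp: supp_on_def)
next
  case (Suc k)
  then obtain K where K: "K \<subseteq> J" "finite K" "card K = k"
    and ind: "\<And>c. c \<in> supp_on K \<Longrightarrow> (\<And>i. i \<in> A \<Longrightarrow> (\<Sum>j\<in>K. c j * v j i) = 0) \<Longrightarrow> c = 0"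
    by (metis Suc_leD)
  have "card K < card A" using K Suc by simp
  from exists_orthogonal[OF assms(1) K(2) this]
  obtain y where y: "y \<in> supp_on A" "y \<noteq> 0" "\<And>j. j \<in> K \<Longrightarrow> (\<Sum>i\<in>A. y i * v j i) = 0"
    by metis
  obtain l where l: "l \<in> J" "(\<Sum>i\<in>A. y i * v l i) \<noteq> 0"
    using sep y by blast
  then have "l \<notin> K" using y by blast
  have ind': "c = 0" if c: "c \<in> supp_on (insert l K)"
    and zero: "\<And>i. i \<in> A \<Longrightarrow> (\<Sum>j\<in>insert l K. c j * v j i) = 0" for c
  proof (rule ind)
    \<comment> \<open>Pairing the relation with \<open>y\<close> removes every term except that of
      \<open>l\<close>.\<close>
    have "0 = (\<Sum>i\<in>A. y i * (\<Sum>j\<in>insert l K. c j * v j i))"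
      using zero by simp
    also have "\<dots> = (\<Sum>j\<in>insert l K. c j * (\<Sum>i\<in>A. y i * v j i))"
      unfolding sum_distrib_left by (subst sum.swap) (simp add: mult.left_commute)
    also have "\<dots> = c l * (\<Sum>i\<in>A. y i * v l i)"
      using K(2) \<open>l \<notin> K\<close> y(3) by simp
    finally have "c l = 0" using l by simp
    then show "c \<in> supp_on K"
      using c by (auto simp: supp_on_def)
    show "(\<Sum>j\<in>K. c j * v j i) = 0" if "i \<in> A" for i
      using zero[OF that] K(2) \<open>l \<notin> K\<close> \<open>c l = 0\<close> by simp
  qed
  show ?case
  proof (intro exI[of _ "insert l K"] conjI ballI impI)
    show "insert l K \<subseteq> J" "finite (insert l K)" "card (insert l K) = Suc k"
      using K l \<open>l \<notin> K\<close> by auto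
  qed (rule ind', assumption, drule (1) bspec, assumption)
qed

lemma sum_fun_apply: "(\<Sum>j\<in>K. f j) i = (\<Sum>j\<in>K. f j i)"
  for f :: "'j \<Rightarrow> 'i \<Rightarrow> 'b::comm_monoid_add"
  by (induction K rule: infinite_finite_induct) auto

text \<open>With as many independent vectors as coordinates, forming combinations is an injection
  between finite sets of equal size, hence onto.\<close>

lemma exists_basis:
  fixes v :: "'j \<Rightarrow> 'i \<Rightarrow> 'b::{field,finite}"
  assumes "finite A" "\<And>j. v j \<in> supp_on A"
    and "\<And>y. y \<in> supp_on A \<Longrightarrow> y \<noteq> 0 \<Longrightarrow> \<exists>j\<in>J. (\<Sum>i\<in>A. y i * v j i) \<noteq> 0"
  shows "\<exists>K\<subseteq>J. finite K \<and> card K = card A \<and>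
    (\<forall>g\<in>supp_on A. \<exists>c. g = (\<Sum>j\<in>K. (\<lambda>i. c j * v j i)))"
proof -
  obtain K where K: "K \<subseteq> J" "finite K" "card K = card A"
    and ind: "\<And>c. c \<in> supp_on K \<Longrightarrow> (\<And>i. i \<in> A \<Longrightarrow> (\<Sum>j\<in>K. c j * v j i) = 0) \<Longrightarrow> c = 0"
    using exists_independent[OF assms(1,3) order_refl] by blast
  define \<phi> where "\<phi> c = (\<Sum>j\<in>K. (\<lambda>i. c j * v j i))" for c
  have inj: "inj_on \<phi> (supp_on K)"
  proof (rule inj_onI)
    fix c c' assume c: "c \<in> supp_on K" "c' \<in> supp_on K" "\<phi> c = \<phi> c'"
    have "c - c' = 0"
    proof (rule ind)
      show "(\<Sum>j\<in>K. (c - c') j * v j i) = 0" for i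
        using fun_cong[OF c(3), of i]
        by (simp add: \<phi>_def sum_fun_apply left_diff_distrib sum_subtractf)
    qed (rule supp_on_diff[OF c(1,2)])
    then show "c = c'" by simp
  qed
  have "\<phi> ` supp_on K \<subseteq> supp_on A"
    using assms(2) by (auto simp: \<phi>_def supp_on_def sum_fun_apply)
  then have image: "\<phi> ` supp_on K = supp_on A"
    using assms(1) K
    by (intro card_subset_eq) (simp_all add: finite_supp_on card_image inj card_supp_on)
  show ?thesis
  proof (intro exI[of _ K] conjI ballI K)
    fix g :: "'i \<Rightarrow> 'b" assume "g \<in> supp_on A"
    then obtain c where "g = \<phi> c" using image by blast
    then show "\<exists>c. g = (\<Sum>j\<in>K. (\<lambda>i. c j * v j i))"
      by (intro exI[of _ c]) (simp add: \<phi>_def)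
  qed
qed

subsection \<open>Growth of the set of subset sums\<close>

definition subset_sums :: "('j \<Rightarrow> 'a::comm_monoid_add) \<Rightarrow> 'j set \<Rightarrow> 'a set" where
  "subset_sums v I = sum v ` Pow I"

lemma finite_subset_sums: "finite I \<Longrightarrow> finite (subset_sums v I)"
  by (simp add: subset_sums_def)

lemma subset_sums_insert:
  assumes "finite I" "j \<notin> I"
  shows "subset_sums v (insert j I) = subset_sums v I \<union> (+) (v j) ` subset_sums v I"
proof -
  have "sum v (insert j X) = v j + sum v X" if "X \<in> Pow I" for X
    using that assms finite_subset by (subst sum.insert) auto
  then show ?thesis
    unfolding subset_sums_def Pow_insert image_Un image_image by simp
qed

text \<open>The new sums are a translate of the old ones, so a lower bound on the defect of the
  added vector is a lower bound on growth.\<close>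

lemma card_subset_sums_insert:
  fixes v :: "'j \<Rightarrow> 'a::ab_group_add"
  assumes "finite I" "j \<notin> I"
  shows "card (subset_sums v (insert j I)) = card (subset_sums v I) + defect (subset_sums v I) (v j)"
proof -
  have "subset_sums v (insert j I) =
      subset_sums v I \<union> ((+) (v j) ` subset_sums v I - subset_sums v I)"
    using subset_sums_insert[OF assms, of v] by auto
  then show ?thesis
    using finite_subset_sums[OF assms(1), of v]
    by (simp add: defect_def card_Un_disjoint del: Un_Diff_cancel)
qed

lemma subset_sums_subset:
  fixes v :: "'j \<Rightarrow> 'i \<Rightarrow> 'b::comm_monoid_add"
  assumes "\<And>j. v j \<in> supp_on A"
  shows "subset_sums v I \<subseteq> supp_on A"
  using assms by (auto simp: subset_sums_def supp_on_def sum_fun_apply)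

text \<open>A \<open>g\<close> of at least average defect is a combination of \<open>card A\<close>
  vectors of the family. Scaling multiplies a defect by at most \<open>(p - 1) / 2\<close>, so by
  subadditivity the basis vector of largest defect has at least the fraction
  \<open>2 / (card A * (p - 1))\<close> of the defect of \<open>g\<close>.\<close>

lemma exists_good_vector:
  fixes v :: "'j \<Rightarrow> 'i \<Rightarrow> 'p::prime_card mod_ring"
  assumes "finite A" "A \<noteq> {}" "odd CARD('p)" "\<And>j. v j \<in> supp_on A" "S \<subseteq> supp_on A"
    and sep: "\<And>y. y \<in> supp_on A \<Longrightarrow> y \<noteq> 0 \<Longrightarrow> \<exists>j\<in>J. (\<Sum>i\<in>A. y i * v j i) \<noteq> 0"
  defines "N \<equiv> CARD('p) ^ card A"
  shows "\<exists>j\<in>J. 2 * (card S * (N - card S)) \<le> N * (card A * (CARD('p) - 1)) * defect S (v j)"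
proof -
  have N: "card (supp_on A :: ('i \<Rightarrow> 'p mod_ring) set) = N"
    by (simp add: N_def card_supp_on assms(1))
  have finS: "finite S"
    using assms(1,5) finite_subset finite_supp_on by blast
  obtain g where g: "g \<in> supp_on A" "card S * (N - card S) \<le> N * defect S g"
    using exists_defect_ge[OF finite_supp_on[OF assms(1)] assms(5)] supp_on_add supp_on_diff N
    by (metis empty_iff zero_in_supp_on)
  obtain K where K: "K \<subseteq> J" "finite K" "card K = card A"
    and span: "\<And>g. g \<in> supp_on A \<Longrightarrow> \<exists>c. g = (\<Sum>j\<in>K. (\<lambda>i. c j * v j i))"
    using exists_basis[OF assms(1,4) sep] by blast
  obtain c where c: "g = (\<Sum>j\<in>K. (\<lambda>i. c j * v j i))"
    using span g(1) by blast
  have "K \<noteq> {}" using K assms(1,2) by auto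
  define D where "D = Max ((\<lambda>j. defect S (v j)) ` K)"
  have "D \<in> (\<lambda>j. defect S (v j)) ` K"
    unfolding D_def using K \<open>K \<noteq> {}\<close> by (intro Max_in) auto
  then obtain j where j: "j \<in> K" "D = defect S (v j)" by auto
  have "2 * defect S g \<le> (\<Sum>j\<in>K. 2 * defect S (\<lambda>i. c j * v j i))"
    using defect_sum_le[OF finS K(2), of "\<lambda>j i. c j * v j i"]
    by (simp add: c flip: sum_distrib_left)
  also have "\<dots> \<le> (\<Sum>j\<in>K. (CARD('p) - 1) * D)"
  proof (rule sum_mono)
    fix l assume "l \<in> K"
    then have "defect S (v l) \<le> D"
      unfolding D_def using K by (intro Max_ge) auto
    then show "2 * defect S (\<lambda>i. c l * v l i) \<le> (CARD('p) - 1) * D"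
      using defect_mod_ring_mult_le[OF finS assms(3), of "c l" "v l"]
      by (meson le_trans mult_le_mono2)
  qed
  also have "\<dots> = card A * (CARD('p) - 1) * D"
    using K by simp
  finally have le: "2 * defect S g \<le> card A * (CARD('p) - 1) * D" .
  have "2 * (card S * (N - card S)) \<le> N * (2 * defect S g)"
    using g(2) by simp
  also have "\<dots> \<le> N * (card A * (CARD('p) - 1) * D)"
    using le by (rule mult_le_mono2)
  finally have "2 * (card S * (N - card S)) \<le> N * (card A * (CARD('p) - 1)) * D"
    by (simp only: mult.assoc)
  then show ?thesis using j K by blast
qed

text \<open>The assumption \<open>odds\<close> says that \<open>s / (N - s)\<close> is at least
  \<open>q\<close> times \<open>1 / (N - 1)\<close>, the odds of a one-point set. The
  cross-multiplied form still makes sense at \<open>s = N\<close>.\<close>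

lemma odds_step:
  fixes s s' N r q :: real
  assumes "1 \<le> N" "0 \<le> s" "s \<le> N" "0 \<le> r" "0 \<le> q"
    and odds: "q * (N - s) \<le> s * (N - 1)"
    and step: "s + r * s * (N - s) / N \<le> s'"
  shows "q * (1 + r) * (N - s') \<le> s' * (N - 1)"
proof -
  have N: "0 < N" using assms(1) by simp
  \<comment> \<open>The complement shrinks to at most \<open>(N - s) * t\<close>, while
    \<open>s\<close> grows to at least \<open>s * (r + t)\<close>, and
    \<open>r + t \<ge> (1 + r) * t\<close>. For \<open>t \<ge> 0\<close> the common factor
    \<open>t\<close> leaves the gain \<open>1 + r\<close>; for \<open>t < 0\<close> the left side of
    the goal is bounded by 0.\<close>
  define t where "t = 1 - r * s / N"
  have lower: "s * ((1 + r) * t) \<le> s'"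
  proof -
    have "s + r * s * (N - s) / N = s * (r + t)"
      using N by (simp add: t_def field_simps)
    moreover have "r * t \<le> r * 1"
      using assms by (intro mult_left_mono) (use N in \<open>auto simp: t_def\<close>)
    then have "s * ((1 + r) * t) \<le> s * (r + t)"
      using assms(2) by (intro mult_left_mono) (auto simp: algebra_simps)
    ultimately show ?thesis
      using step by linarith
  qed
  have "s' \<ge> 0"
    using step N assms by (smt (verit) divide_nonneg_nonneg mult_nonneg_nonneg)
  show ?thesis
  proof (cases "s' \<le> N")
    case False
    then have "q * (1 + r) * (N - s') \<le> 0"
      using assms by (intro mult_nonneg_nonpos) auto
    also have "0 \<le> s' * (N - 1)"
      using \<open>s' \<ge> 0\<close> assms by simp
    finally show ?thesis .
  next
    case le: True
    have "N - s' \<le> (N - s) * t"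
      using step N by (simp add: t_def field_simps)
    then have "q * (1 + r) * (N - s') \<le> q * (1 + r) * ((N - s) * t)"
      using assms by (intro mult_left_mono) auto
    also have "\<dots> = q * (N - s) * ((1 + r) * t)" by simp
    also have "\<dots> \<le> s' * (N - 1)"
    proof (cases "t \<ge> 0")
      case True
      then have "q * (N - s) * ((1 + r) * t) \<le> s * (N - 1) * ((1 + r) * t)"
        using odds assms by (intro mult_right_mono) auto
      also have "\<dots> = s * ((1 + r) * t) * (N - 1)" by simp
      also have "\<dots> \<le> s' * (N - 1)"
        using lower assms by (intro mult_right_mono) auto
      finally show ?thesis .
    next
      case False
      then have "q * (N - s) * ((1 + r) * t) \<le> 0"
        using assms by (intro mult_nonneg_nonpos) (auto intro: mult_nonneg_nonpos)
      also have "0 \<le> s' * (N - 1)"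
        using \<open>s' \<ge> 0\<close> assms by simp
      finally show ?thesis .
    qed
    finally show ?thesis .
  qed
qed

lemma subset_sums_growth:
  fixes v :: "'j \<Rightarrow> 'i \<Rightarrow> 'p::prime_card mod_ring" and N r :: real
  assumes "finite A" "A \<noteq> {}" "odd CARD('p)" "\<And>j. v j \<in> supp_on A"
    and weight: "\<And>y. y \<in> supp_on A \<Longrightarrow> y \<noteq> 0 \<Longrightarrow> d \<le> card {j \<in> J. (\<Sum>i\<in>A. y i * v j i) \<noteq> 0}"
    and "k \<le> d"
  defines "N \<equiv> real (CARD('p) ^ card A)" and "r \<equiv> 2 / (real (card A) * (real CARD('p) - 1))"
  shows "\<exists>I\<subseteq>J. finite I \<and> card I = k \<and>
    (1 + r) ^ k * (N - card (subset_sums v I)) \<le> card (subset_sums v I) * (N - 1)"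
  using \<open>k \<le> d\<close>
proof (induction k)
  case 0
  \<comment> \<open>Only the empty sum is present, so both sides equal \<open>N - 1\<close>.\<close>
  then show ?case by (intro exI[of _ "{}"]) (simp add: subset_sums_def)
next
  case (Suc k)
  then obtain I where I: "I \<subseteq> J" "finite I" "card I = k"
    and odds: "(1 + r) ^ k * (N - card (subset_sums v I)) \<le> card (subset_sums v I) * (N - 1)"
    by (metis Suc_leD)
  define S where "S = subset_sums v I"
  have p: "1 < CARD('p)"
    using nontriv[where 'a = 'p] .
  have m: "0 < card A" using assms(1,2) by auto
  have S: "S \<subseteq> supp_on A"
    unfolding S_def using assms(4) by (rule subset_sums_subset)
  then have "card S \<le> card (supp_on A :: ('i \<Rightarrow> 'p mod_ring) set)"
    using finite_supp_on[OF assms(1)] by (rule card_mono[rotated])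
  then have cardS: "card S \<le> CARD('p) ^ card A"
    by (simp add: card_supp_on assms(1))
  have "\<exists>j\<in>J - I. (\<Sum>i\<in>A. y i * v j i) \<noteq> 0" if "y \<in> supp_on A" "y \<noteq> 0" for y
  proof (rule ccontr)
    assume "\<not> ?thesis"
    then have "card {j \<in> J. (\<Sum>i\<in>A. y i * v j i) \<noteq> 0} \<le> card I"
      using I(2) by (intro card_mono) auto
    then show False using weight[OF that] I Suc.prems by simp
  qed
  from exists_good_vector[OF assms(1-4) S this] obtain j where j: "j \<in> J - I"
    and good: "2 * (card S * (CARD('p) ^ card A - card S))
      \<le> CARD('p) ^ card A * (card A * (CARD('p) - 1)) * defect S (v j)"
    by blast
  have "real (2 * (card S * (CARD('p) ^ card A - card S)))
      \<le> real (CARD('p) ^ card A * (card A * (CARD('p) - 1)) * defect S (v j))"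
    using good by (rule of_nat_mono)
  then have "2 * (card S * (N - card S)) \<le> N * (card A * (real CARD('p) - 1)) * defect S (v j)"
    using cardS p by (simp add: N_def of_nat_diff)
  then have "r * card S * (N - card S) / N \<le> defect S (v j)"
    using p m by (simp add: r_def N_def field_simps)
  then have step: "card S + r * card S * (N - card S) / N \<le> card (subset_sums v (insert j I))"
    using card_subset_sums_insert[of I j v] I j by (simp add: S_def)
  have "1 \<le> N"
    unfolding N_def using p by simp
  moreover have "0 \<le> r"
    unfolding r_def using p by simp
  ultimately have "(1 + r) ^ k * (1 + r) * (N - card (subset_sums v (insert j I)))
      \<le> card (subset_sums v (insert j I)) * (N - 1)"
    using odds cardS step by (intro odds_step[where s = "card S"]) (auto simp: S_def N_def)
  then show ?case
    using I j by (intro exI[of _ "insert j I"]) (auto simp: mult.commute)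
qed

text \<open>In logarithms the claim is \<open>2 * m * ln p \<le> d * ln (1 + r)\<close>. Bernoulli's
  inequality gives \<open>ln (1 + r) \<ge> 2 * L / m\<close>, and \<open>C_E p\<close> is
  \<open>ln p / L\<close>.\<close>

lemma steps_suffice:
  fixes p m d :: nat
  assumes "p \<ge> 2" "m \<ge> 1" "real d \<ge> C_E p * real m ^ 3"
  shows "real (p ^ m) ^ 2 \<le> (1 + 2 / (real m * (real p - 1))) ^ d"
proof -
  define r where "r = 2 / (real m * (real p - 1))"
  define L where "L = ln (real p + 1) - ln (real p)"
  have r: "r > 0" using assms by (simp add: r_def)
  have L: "L > 0" using assms by (simp add: L_def)
  have C: "C_E p = ln (real p) / L"
    using assms by (simp add: C_E_def L_def field_simps)
  \<comment> \<open>This links the ratio \<open>(p + 1) / p\<close> behind \<open>C_E\<close> to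
    \<open>m * r = 2 / (p - 1)\<close>; squaring matches the 2 in the numerator.\<close>
  have "(1 + 1 / real p) ^ 2 \<le> 1 + 2 / (real p - 1)"
    using assms by (simp add: field_simps power2_eq_square)
  also have "\<dots> = 1 + real m * r"
    using assms by (simp add: r_def)
  also have "\<dots> \<le> (1 + r) ^ m"
    using r by (intro Bernoulli_inequality) simp
  finally have "ln ((1 + 1 / real p) ^ 2) \<le> ln ((1 + r) ^ m)"
    by (intro ln_mono zero_less_power) (simp_all add: add_pos_nonneg)
  moreover have "1 + 1 / real p = (real p + 1) / real p"
    using assms by (simp add: field_simps)
  ultimately have key: "2 * L \<le> m * ln (1 + r)"
    using assms r by (simp add: ln_realpow L_def ln_div)
  have "2 * (m * ln (real p)) = C_E p * m * (2 * L)"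
    using L by (simp add: C)
  also have "\<dots> \<le> C_E p * m * (m * ln (1 + r))"
    using key assms L by (intro mult_left_mono) (auto simp: C)
  also have "\<dots> = C_E p * real m ^ 2 * ln (1 + r)"
    by (simp add: power2_eq_square)
  also have "\<dots> \<le> C_E p * real m ^ 3 * ln (1 + r)"
    using assms L r by (intro mult_right_mono mult_left_mono power_increasing) (auto simp: C)
  also have "\<dots> \<le> d * ln (1 + r)"
    using assms r by (intro mult_right_mono) auto
  finally have "ln (real (p ^ m) ^ 2) \<le> ln ((1 + r) ^ d)"
    using assms r by (simp add: ln_realpow)
  then show ?thesis
    unfolding r_def[symmetric] using assms r by (subst (asm) ln_le_cancel_iff) auto
qed

text \<open>If a point were missed, the set would have at most \<open>N - 1\<close> elements and its
  complement at least one. The growth estimate would then bound \<open>(1 + r) ^ d\<close> by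
  \<open>(N - 1) ^ 2\<close>, below the \<open>N ^ 2\<close> from
  \<open>steps_suffice\<close>.\<close>

lemma subset_sums_eq_supp_on:
  fixes v :: "'j \<Rightarrow> 'i \<Rightarrow> 'p::prime_card mod_ring"
  assumes "finite A" "A \<noteq> {}" "odd CARD('p)" "\<And>j. v j \<in> supp_on A"
    and weight: "\<And>y. y \<in> supp_on A \<Longrightarrow> y \<noteq> 0 \<Longrightarrow> d \<le> card {j \<in> J. (\<Sum>i\<in>A. y i * v j i) \<noteq> 0}"
    and d: "real d \<ge> C_E CARD('p) * real (card A) ^ 3"
  shows "\<exists>I\<subseteq>J. subset_sums v I = supp_on A"
proof -
  define N where "N = CARD('p) ^ card A"
  define r where "r = 2 / (real (card A) * (real CARD('p) - 1))"
  from subset_sums_growth[OF assms(1-4) weight order_refl]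
  obtain I where I: "I \<subseteq> J"
    and odds: "(1 + r) ^ d * (N - real (card (subset_sums v I))) \<le> card (subset_sums v I) * (real N - 1)"
    unfolding r_def N_def by blast
  define s where "s = card (subset_sums v I)"
  have sub: "subset_sums v I \<subseteq> supp_on A"
    using assms(4) by (rule subset_sums_subset)
  have N: "card (supp_on A :: ('i \<Rightarrow> 'p mod_ring) set) = N"
    by (simp add: N_def card_supp_on assms(1))
  have "s = N"
  proof (rule ccontr)
    assume "s \<noteq> N"
    then have "s < N"
      using card_mono[OF finite_supp_on[OF assms(1)] sub] N by (simp add: s_def)
    have "real N ^ 2 \<le> (1 + r) ^ d * 1"
      unfolding N_def r_def using steps_suffice[of "CARD('p)" "card A" d] d assms(1,2)
        nontriv[where 'a = 'p] by (simp add: Suc_le_eq card_gt_0_iff)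
    also have "\<dots> \<le> (1 + r) ^ d * (real N - s)"
      using \<open>s < N\<close> nontriv[where 'a = 'p] by (intro mult_left_mono) (auto simp: r_def)
    also have "\<dots> \<le> s * (real N - 1)"
      using odds by (simp add: s_def)
    also have "\<dots> \<le> (real N - 1) * (real N - 1)"
      using \<open>s < N\<close> by (intro mult_right_mono) auto
    also have "\<dots> < real N ^ 2"
      using \<open>s < N\<close> by (simp add: power2_eq_square algebra_simps)
    finally show False by simp
  qed
  then have "subset_sums v I = supp_on A"
    using sub N finite_supp_on[OF assms(1)] by (intro card_subset_eq) (auto simp: s_def)
  then show ?thesis using I by blast
qed

section \<open>From matrices to families of columns\<close>

text \<open>The minimum is over a finite set, since weights are bounded by the number of
  columns.\<close>

lemma min_weight_le:
  fixes M :: "'p::prime_card mod_ring mat"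
  assumes "y \<in> carrier_vec (dim_row M)" "y \<noteq> 0\<^sub>v (dim_row M)"
  shows "min_weight M \<le> hamming_weight (transpose_mat M *\<^sub>v y)"
proof -
  have "hamming_weight (transpose_mat M *\<^sub>v z) \<le> card {..<dim_col M}" for z
    unfolding hamming_weight_def by (rule card_mono) auto
  then have "finite {hamming_weight (transpose_mat M *\<^sub>v y) | y.
      y \<in> carrier_vec (dim_row M) \<and> y \<noteq> 0\<^sub>v (dim_row M)}"
    by (intro finite_subset[OF _ finite_atMost[of "card {..<dim_col M}"]]) blast+
  then show ?thesis
    unfolding min_weight_def using assms by (intro Min_le) auto
qed

theorem theorem5p2:
  fixes M :: "'p :: prime_card mod_ring mat"
    and a :: "'p mod_ring vec"
    and m n :: nat
  assumes "CARD('p) \<ge> 5"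
    and "M \<in> carrier_mat m n"
    and "a \<in> carrier_vec m"
    and "real (min_weight M) \<ge> C_E CARD('p) * real m ^ 3"
  shows "\<exists>x \<in> carrier_vec n. (\<forall>i < n. x $ i \<in> {0, 1}) \<and> M *\<^sub>v x = a"
proof (cases "m = 0")
  \<comment> \<open>Without rows \<open>min_weight M\<close> is unspecified and the coordinate set
    is empty; the zero vector solves the empty system.\<close>
  case True
  then show ?thesis
    using assms by (intro bexI[of _ "0\<^sub>v n"]) auto
next
  case False
  \<comment> \<open>Column \<open>j\<close> of \<open>M\<close>, padded by 0 so that it lies in
    \<open>supp_on {..<m}\<close>.\<close>
  define v where "v j i = (if i < m then M $$ (i, j) else 0)" for i j
  have "odd CARD('p)"
    using assms(1) prime_card[where 'a = 'p] by (intro prime_odd_nat) auto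
  \<comment> \<open>Coordinate \<open>j\<close> of \<open>y\<close> times \<open>M\<close> is the
    pairing of \<open>y\<close> with column \<open>j\<close>, so the count is a Hamming
    weight.\<close>
  moreover have "min_weight M \<le> card {j \<in> {..<n}. (\<Sum>i\<in>{..<m}. y i * v j i) \<noteq> 0}"
    if "y \<in> supp_on {..<m}" "y \<noteq> 0" for y
  proof -
    obtain i where "y i \<noteq> 0" using \<open>y \<noteq> 0\<close> by (auto simp: fun_eq_iff)
    then have "i < m" using that(1) by (force simp: supp_on_def)
    then have "vec m y \<noteq> 0\<^sub>v m"
      using \<open>y i \<noteq> 0\<close> by (metis index_vec index_zero_vec(1))
    then have "min_weight M \<le> hamming_weight (transpose_mat M *\<^sub>v vec m y)"
      using assms(2) by (intro min_weight_le) auto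
    also have "\<dots> = card {j \<in> {..<n}. (\<Sum>i\<in>{..<m}. y i * v j i) \<noteq> 0}"
      unfolding hamming_weight_def using assms(2)
      by (intro arg_cong[where f = card] Collect_cong)
        (auto simp: scalar_prod_def v_def mult.commute atLeast0LessThan)
    finally show ?thesis .
  qed
  ultimately obtain I where I: "I \<subseteq> {..<n}" "subset_sums v I = supp_on {..<m}"
    using subset_sums_eq_supp_on[of "{..<m}" v "min_weight M" "{..<n}"] assms(4) False
    by (auto simp: supp_on_def v_def)
  have "(\<lambda>i. if i < m then a $ i else 0) \<in> subset_sums v I"
    unfolding I(2) by (simp add: supp_on_def)
  then obtain J where J: "J \<subseteq> I" "(\<lambda>i. if i < m then a $ i else 0) = sum v J"
    by (auto simp: subset_sums_def)
  \<comment> \<open>The indicator of the columns whose sum is \<open>a\<close>.\<close>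
  define x where "x = vec n (\<lambda>j. if j \<in> J then 1 else 0 :: 'p mod_ring)"
  have "M *\<^sub>v x = a"
  proof (rule eq_vecI)
    fix i assume "i < dim_vec a"
    then have i: "i < m" using assms(3) by simp
    have "(M *\<^sub>v x) $ i = (\<Sum>j\<in>{..<n}. M $$ (i, j) * (if j \<in> J then 1 else 0))"
      using i assms(2) by (simp add: x_def scalar_prod_def atLeast0LessThan)
    also have "\<dots> = (\<Sum>j\<in>{..<n}. if j \<in> J then v j i else 0)"
      using i by (intro sum.cong) (auto simp: v_def)
    also have "\<dots> = (\<Sum>j\<in>J. v j i)"
      using J(1) I(1) by (simp add: sum.If_cases Int_absorb1 subset_trans)
    also have "\<dots> = a $ i"
      using fun_cong[OF J(2), of i] i by (simp add: sum_fun_apply)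
    finally show "(M *\<^sub>v x) $ i = a $ i" .
  qed (use assms in auto)
  then show ?thesis
    by (intro bexI[of _ x]) (auto simp: x_def)
qed

end
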